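(* Let $c = \dfrac{\log(26/27)}{\log(3/4)}$ (so $c = 0.131\dots$). For all $\alpha\in[0,1]$, $$m(\alpha)\le \frac{27}{26}\,\alpha^{3+c}.$$
   Context: Piecewise constant functions: $f:[0,1]^3\to[0,1]$ is piecewise constant if there are a positive integer $r$ and real numbers $0=x_0\le x_1\le\dots\le x_r=1$, $0=y_0\le\dots\le y_r=1$, $0=z_0\le\dots\le z_r=1$ such that $f$ is constant on $[x_i,x_{i+1})\times[y_j,y_{j+1})\times[z_k,z_{k+1})$ for all $0\le i,j,k\le r-1$. For such $f$ define $$T(f) = \int_0^1\int_0^1\int_0^1 \left(\int_0^1 f(x,y,z')\,dz'\right)\left(\int_0^1 f(x,y',z)\,dy'\right)\left(\int_0^1 f(x',y,z)\,dx'\right)dx\,dy\,dz,$$ and for $\alpha\in[0,1]$ define $m(\alpha) = \inf_f T(f)$, the infimum over all piecewise constant $f:[0,1]^3\to[0,1]$ with $\int_0^1\int_0^1\int_0^1 f(x,y,z)\,dx\,dy\,dz = \alpha$. *)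

theory Defs
  imports "HOL-Analysis.Analysis"
begin

definition unit_partition :: "nat \<Rightarrow> (nat \<Rightarrow> real) \<Rightarrow> bool" where
  "unit_partition r p \<longleftrightarrow> p 0 = 0 \<and> p r = 1 \<and> (\<forall>i<r. p i \<le> p (Suc i))"

text \<open>A function on the unit cube is a curried total function on the reals; its values
  outside the cube are irrelevant to everything below. Since the boxes are half-open, the
  values on the three faces where a coordinate equals 1 are only required to lie in the
  unit interval. These faces do not affect the iterated integrals: as
  \<^const>\<open>integral\<close> ignores negligible sets, each of the nested integrations discards its
  own endpoint 1.\<close>

definition piecewise_constant :: "(real \<Rightarrow> real \<Rightarrow> real \<Rightarrow> real) \<Rightarrow> bool" where
  "piecewise_constant f \<longleftrightarrow>
     (\<forall>x\<in>{0..1}. \<forall>y\<in>{0..1}. \<forall>z\<in>{0..1}. f x y z \<in> {0..1}) \<and>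
     (\<exists>r xs ys zs. r > 0 \<and>
        unit_partition r xs \<and> unit_partition r ys \<and> unit_partition r zs \<and>
        (\<forall>i<r. \<forall>j<r. \<forall>k<r. (\<lambda>(x, y, z). f x y z) constant_on
           {xs i..<xs (Suc i)} \<times> {ys j..<ys (Suc j)} \<times> {zs k..<zs (Suc k)}))"

definition cube_integral :: "(real \<Rightarrow> real \<Rightarrow> real \<Rightarrow> real) \<Rightarrow> real" where
  "cube_integral g =
     integral {0..1} (\<lambda>z. integral {0..1} (\<lambda>y. integral {0..1} (\<lambda>x. g x y z)))"

definition T :: "(real \<Rightarrow> real \<Rightarrow> real \<Rightarrow> real) \<Rightarrow> real" where
  "T f = cube_integral (\<lambda>x y z.
     integral {0..1} (\<lambda>z'. f x y z') *
     integral {0..1} (\<lambda>y'. f x y' z) *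
     integral {0..1} (\<lambda>x'. f x' y z))"

text \<open>For \<^prop>\<open>\<alpha> \<in> {0..1::real}\<close> the set below contains the value of the constant
  function \<open>\<alpha>\<close>, and it is bounded below by 0, so the infimum is a genuine one.\<close>

definition m :: "real \<Rightarrow> real" where
  "m \<alpha> = (INF f \<in> {f. piecewise_constant f \<and> cube_integral f = \<alpha>}. T f)"

end

theory Submission
  imports Defs
begin

text \<open>The extremal building block lives on the grid \<open>{0,1}\<^sup>3\<close>: delete the two corners
  \<open>(0,0,0)\<close> and \<open>(1,1,1)\<close> of the cube. The density is \<open>6/8 = 3/4\<close>. A line in direction \<open>z\<close>
  through \<open>(x,y)\<close> has mean \<open>1/2\<close> when \<open>x = y\<close> and mean \<open>1\<close> otherwise, so the product of three
  line means is \<open>1/8\<close> at the two deleted corners and \<open>1/2\<close> at the other six points, where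
  exactly two coordinates agree. Hence \<open>T\<close> takes the value \<open>(2/8 + 6/2)/8 = 13/32\<close>, which is
  \<open>(3/4)\<^sup>3 \<cdot> 26/27\<close>, and the exponent \<open>3 + c\<close> is chosen to make this \<open>(3/4) powr (3 + c)\<close>.

  Both the density and \<open>T\<close> are multiplicative under tensor products. The \<open>n\<close>-th tensor power,
  read through binary digits as a function on a grid of side \<open>2^n\<close>, therefore has density
  \<open>(3/4)^n\<close> and \<open>T\<close>-value \<open>(13/32)^n\<close> (lemmas \<open>sum_no_mono_digit\<close> and
  \<open>sum_no_mono_digit_lines\<close>). Multiplying it by a constant \<open>\<beta>\<close> multiplies the density by
  \<open>\<beta>\<close> and \<open>T\<close> by \<open>\<beta>\<^sup>3\<close>. Any \<open>\<alpha>\<close> with \<open>0 < \<alpha> \<le> 1\<close> is \<open>\<beta> (3/4)^n\<close> for some \<open>\<beta>\<close> between \<open>3/4\<close> and \<open>1\<close>, and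
  the scaling costs the factor \<open>\<beta> powr (-c)\<close>, which is at most
  \<open>(3/4) powr (-c) = 27/26\<close>.\<close>

section \<open>Grid functions on the unit cube\<close>

text \<open>The integrand is the constant \<open>h i\<close> inside the \<open>i\<close>-th cell, so the integral is built up one
  cell at a time; the finitely many cell boundaries form a null set. As \<open>h\<close> is arbitrary, the
  equation can rewrite nested integrals from the inside out: each inner integral is again a
  function of the floors of the remaining coordinates.\<close>

lemma integral_grid_function:
  fixes h :: "nat \<Rightarrow> real"
  assumes "N > 0"
  shows "integral {0..1} (\<lambda>x. h (nat \<lfloor>real N * x\<rfloor>)) = (\<Sum>i<N. h i) / real N"
proof -
  have "((\<lambda>x. h (nat \<lfloor>real N * x\<rfloor>)) has_integral (\<Sum>i<k. h i) / real N) {0..real k / real N}" for k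
  proof (induction k)
    case 0
    then show ?case by (simp add: has_integral_refl)
  next
    case (Suc k)
    have "((\<lambda>x. h k) has_integral (real (Suc k) / real N - real k / real N) * h k)
            {real k / real N..real (Suc k) / real N}"
      using has_integral_const_real[of "h k" "real k / real N" "real (Suc k) / real N"] assms
      by (simp add: divide_right_mono)
    moreover have "h (nat \<lfloor>real N * x\<rfloor>) = h k"
      if "x \<in> {real k / real N<..<real (Suc k) / real N}" for x
    proof -
      have "\<lfloor>real N * x\<rfloor> = int k"
        using that assms by (intro floor_unique) (auto simp: field_simps)
      then show ?thesis by simp
    qed
    ultimately have "((\<lambda>x. h (nat \<lfloor>real N * x\<rfloor>)) has_integral
            (real (Suc k) / real N - real k / real N) * h k) {real k / real N..real (Suc k) / real N}"
      by (intro has_integral_spike_interior[where f = "\<lambda>x. h k" and g = "\<lambda>x. h (nat \<lfloor>real N * x\<rfloor>)"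
            and a = "real k / real N" and b = "real (Suc k) / real N", simplified box_real]) auto
    then have "((\<lambda>x. h (nat \<lfloor>real N * x\<rfloor>)) has_integral
        (\<Sum>i<k. h i) / real N + (real (Suc k) / real N - real k / real N) * h k)
        {0..real (Suc k) / real N}"
      using Suc by (intro has_integral_combine[of 0 "real k / real N"]) (auto simp: divide_right_mono)
    then show ?case
      by (simp add: add_divide_distrib algebra_simps)
  qed
  from this[of N] show ?thesis
    using assms by (simp add: integral_unique)
qed

definition grid_function :: "nat \<Rightarrow> (nat \<Rightarrow> nat \<Rightarrow> nat \<Rightarrow> real) \<Rightarrow> real \<Rightarrow> real \<Rightarrow> real \<Rightarrow> real" where
  "grid_function N w x y z = w (nat \<lfloor>real N * x\<rfloor>) (nat \<lfloor>real N * y\<rfloor>) (nat \<lfloor>real N * z\<rfloor>)"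

lemma cube_integral_grid_function:
  assumes "N > 0"
  shows "cube_integral (grid_function N w) = (\<Sum>k<N. \<Sum>j<N. \<Sum>i<N. w i j k) / real N ^ 3"
proof -
  have "cube_integral (grid_function N w) =
      (\<Sum>k<N. (\<Sum>j<N. (\<Sum>i<N. w i j k) / real N) / real N) / real N"
    unfolding cube_integral_def grid_function_def
    by (subst integral_grid_function[OF assms])+ (rule refl)
  then show ?thesis
    by (simp add: power3_eq_cube flip: sum_divide_distrib)
qed

lemma T_grid_function:
  assumes "N > 0"
  shows "T (grid_function N w) =
    (\<Sum>k<N. \<Sum>j<N. \<Sum>i<N. (\<Sum>k'<N. w i j k') * (\<Sum>j'<N. w i j' k) * (\<Sum>i'<N. w i' j k))
      / real N ^ 6"
proof -
  \<comment> \<open>The product of the three line means is itself a grid function.\<close>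
  let ?v = "\<lambda>i j k. ((\<Sum>k'<N. w i j k') / real N) * ((\<Sum>j'<N. w i j' k) / real N)
              * ((\<Sum>i'<N. w i' j k) / real N)"
  have lines: "integral {0..1} (\<lambda>z'. grid_function N w x y z') * integral {0..1} (\<lambda>y'. grid_function N w x y' z)
      * integral {0..1} (\<lambda>x'. grid_function N w x' y z) = grid_function N ?v x y z" for x y z
    unfolding grid_function_def by (subst integral_grid_function[OF assms])+ (rule refl)
  have "T (grid_function N w) = cube_integral (grid_function N ?v)"
    unfolding T_def lines ..
  also have "\<dots> = (\<Sum>k<N. \<Sum>j<N. \<Sum>i<N. ?v i j k) / real N ^ 3"
    by (rule cube_integral_grid_function[OF assms])
  also have "?v = (\<lambda>i j k. ((\<Sum>k'<N. w i j k') * (\<Sum>j'<N. w i j' k) * (\<Sum>i'<N. w i' j k)) / real N ^ 3)"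
    by (simp add: power3_eq_cube)
  finally show ?thesis
    by (simp flip: sum_divide_distrib power_add)
qed

lemma piecewise_constant_grid_function:
  assumes "N > 0" and range: "\<And>i j k. w i j k \<in> {0..1}"
  shows "piecewise_constant (grid_function N w)"
proof -
  have part: "unit_partition N (\<lambda>i. real i / real N)"
    using assms by (auto simp: unit_partition_def divide_right_mono)
  have cell: "nat \<lfloor>real N * x\<rfloor> = i" if "x \<in> {real i / real N..<real (Suc i) / real N}" for x i
  proof -
    have "\<lfloor>real N * x\<rfloor> = int i"
      using that assms by (intro floor_unique) (auto simp: field_simps)
    then show ?thesis by simp
  qed
  have "(\<lambda>(x, y, z). grid_function N w x y z) constant_on
      {real i / real N..<real (Suc i) / real N} \<times> {real j / real N..<real (Suc j) / real N}
        \<times> {real k / real N..<real (Suc k) / real N}" for i j k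
    unfolding constant_on_def
    by (rule exI[of _ "w i j k"]) (auto simp only: grid_function_def cell split: prod.splits)
  with part \<open>N > 0\<close> have "\<exists>r xs ys zs. r > 0 \<and>
        unit_partition r xs \<and> unit_partition r ys \<and> unit_partition r zs \<and>
        (\<forall>i<r. \<forall>j<r. \<forall>k<r. (\<lambda>(x, y, z). grid_function N w x y z) constant_on
           {xs i..<xs (Suc i)} \<times> {ys j..<ys (Suc j)} \<times> {zs k..<zs (Suc k)})"
    by (intro exI[of _ N] exI[of _ "\<lambda>i. real i / real N"]) simp
  moreover have "grid_function N w x y z \<in> {0..1}" for x y z
    unfolding grid_function_def by (rule range)
  ultimately show ?thesis
    unfolding piecewise_constant_def by blast
qed

section \<open>The infimum as a lower bound\<close>

text \<open>A non-integrable function has integral 0 by convention. The lemma therefore applies at each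
  level of an iterated integral without proving the inner integrals measurable.\<close>

lemma integral_nonneg_total:
  fixes g :: "real \<Rightarrow> real"
  assumes "\<And>x. x \<in> S \<Longrightarrow> g x \<ge> 0"
  shows "integral S g \<ge> 0"
  using assms by (cases "g integrable_on S") (auto simp: integral_nonneg not_integrable_integral)

lemma m_le_T:
  assumes "piecewise_constant f" and "cube_integral f = \<alpha>"
  shows "m \<alpha> \<le> T f"
proof -
  have "T g \<ge> 0" if "piecewise_constant g" for g
  proof -
    have "\<forall>x\<in>{0..1}. \<forall>y\<in>{0..1}. \<forall>z\<in>{0..1}. g x y z \<in> {0..1}"
      using that unfolding piecewise_constant_def by (rule conjunct1)
    then have "g x y z \<ge> 0" if "x \<in> {0..1}" "y \<in> {0..1}" "z \<in> {0..1}" for x y z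
      using that by (meson atLeastAtMost_iff)
    then show ?thesis
      unfolding T_def cube_integral_def
      by (intro integral_nonneg_total mult_nonneg_nonneg) auto
  qed
  then have "bdd_below (T ` {f. piecewise_constant f \<and> cube_integral f = \<alpha>})"
    by (intro bdd_belowI2[of _ 0]) auto
  then show ?thesis
    unfolding m_def using assms by (intro cINF_lower) auto
qed

section \<open>Tensor powers of the cube without two opposite corners\<close>

text \<open>The \<open>n\<close>-th tensor power of the building block: the indicator that at none of the \<open>n\<close> lowest
  binary places do the digits of \<open>i\<close>, \<open>j\<close>, \<open>k\<close> all agree. Peeling off the lowest digit makes
  the recursion match the splitting of \<open>{..<2^(n+1)}\<close> into even and odd numbers.\<close>

primrec no_mono_digit :: "nat \<Rightarrow> nat \<Rightarrow> nat \<Rightarrow> nat \<Rightarrow> real" where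
  "no_mono_digit 0 i j k = 1"
| "no_mono_digit (Suc n) i j k =
     (if i mod 2 = j mod 2 \<and> j mod 2 = k mod 2 then 0
      else no_mono_digit n (i div 2) (j div 2) (k div 2))"

lemma no_mono_digit_range: "no_mono_digit n i j k \<in> {0..1}"
  by (induction n arbitrary: i j k) auto

lemma no_mono_digit_swap:
  "no_mono_digit n i j k = no_mono_digit n i k j" "no_mono_digit n i j k = no_mono_digit n j k i"
  by (induction n arbitrary: i j k) auto

lemma sum_lessThan_even_odd:
  fixes g :: "nat \<Rightarrow> 'a::comm_monoid_add"
  shows "(\<Sum>i<2 * M. g i) = (\<Sum>i<M. g (2 * i) + g (2 * i + 1))"
  by (induction M) (auto simp: algebra_simps)

definition line_sum :: "nat \<Rightarrow> nat \<Rightarrow> nat \<Rightarrow> real" where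
  "line_sum n i j = (\<Sum>k<2 ^ n. no_mono_digit n i j k)"

text \<open>One digit factors out of a line sum: equal digits of \<open>i\<close> and \<open>j\<close> leave one choice for the
  digit of \<open>k\<close>, distinct digits leave two.\<close>

lemma line_sum_Suc:
  "line_sum (Suc n) i j = (if i mod 2 = j mod 2 then 1 else 2) * line_sum n (i div 2) (j div 2)"
proof -
  have "line_sum (Suc n) i j = (\<Sum>k<2 ^ n. (if i mod 2 = j mod 2 then 1 else 2) *
      no_mono_digit n (i div 2) (j div 2) k)"
    unfolding line_sum_def power_Suc sum_lessThan_even_odd
    by (intro sum.cong refl) auto
  then show ?thesis
    by (simp add: line_sum_def sum_distrib_left)
qed

text \<open>Each additional digit contributes a factor 6, as six of the eight triples of digits are not
  constant.\<close>

lemma sum_no_mono_digit: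
  "(\<Sum>k<2 ^ n. \<Sum>j<2 ^ n. \<Sum>i<2 ^ n. no_mono_digit n i j k) = 6 ^ n"
proof (induction n)
  case (Suc n)
  have "(\<Sum>k<2 ^ Suc n. \<Sum>j<2 ^ Suc n. \<Sum>i<2 ^ Suc n. no_mono_digit (Suc n) i j k)
      = (\<Sum>k<2 ^ n. \<Sum>j<2 ^ n. \<Sum>i<2 ^ n. 6 * no_mono_digit n i j k)"
    unfolding power_Suc sum_lessThan_even_odd
    by (simp flip: sum.distrib)
  then show ?case
    using Suc by (simp flip: sum_distrib_left)
qed simp

text \<open>The factor is the unnormalised value \<open>2 \<cdot> 1 + 6 \<cdot> 4 = 26\<close> of the building block: the product
  of the three line sums is \<open>1\<close> when the three digits agree and \<open>2 \<cdot> 2 \<cdot> 1\<close> otherwise.\<close>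

lemma sum_line_sum_products:
  "(\<Sum>k<2 ^ n. \<Sum>j<2 ^ n. \<Sum>i<2 ^ n. line_sum n i j * line_sum n i k * line_sum n j k) = 26 ^ n"
proof (induction n)
  case 0
  then show ?case by (simp add: line_sum_def)
next
  case (Suc n)
  have "(\<Sum>k<2 ^ Suc n. \<Sum>j<2 ^ Suc n. \<Sum>i<2 ^ Suc n.
        line_sum (Suc n) i j * line_sum (Suc n) i k * line_sum (Suc n) j k)
      = (\<Sum>k<2 ^ n. \<Sum>j<2 ^ n. \<Sum>i<2 ^ n. 26 * (line_sum n i j * line_sum n i k * line_sum n j k))"
    unfolding power_Suc sum_lessThan_even_odd
    by (simp add: line_sum_Suc flip: sum.distrib) (simp add: mult_ac)
  then show ?case
    using Suc by (simp flip: sum_distrib_left)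
qed

lemma sum_no_mono_digit_lines:
  "(\<Sum>k<2 ^ n. \<Sum>j<2 ^ n. \<Sum>i<2 ^ n. (\<Sum>k'<2 ^ n. no_mono_digit n i j k') *
      (\<Sum>j'<2 ^ n. no_mono_digit n i j' k) * (\<Sum>i'<2 ^ n. no_mono_digit n i' j k)) = 26 ^ n"
proof -
  have "(\<Sum>j'<2 ^ n. no_mono_digit n i j' k) = line_sum n i k" for i k
    unfolding line_sum_def by (intro sum.cong refl no_mono_digit_swap)
  moreover have "(\<Sum>i'<2 ^ n. no_mono_digit n i' j k) = line_sum n j k" for j k
    unfolding line_sum_def by (intro sum.cong refl no_mono_digit_swap)
  ultimately show ?thesis
    using sum_line_sum_products[of n] by (simp flip: line_sum_def)
qed

section \<open>The upper bound\<close>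

lemma m_scaled_power_le:
  fixes \<beta> :: real
  assumes "\<beta> \<in> {0..1}"
  shows "m (\<beta> * (3/4) ^ n) \<le> \<beta> ^ 3 * (13/32) ^ n"
proof -
  let ?w = "\<lambda>i j k. \<beta> * no_mono_digit n i j k"
  let ?f = "grid_function (2 ^ n) ?w"
  have pc: "piecewise_constant ?f"
    using assms no_mono_digit_range[of n]
    by (intro piecewise_constant_grid_function) (auto intro: mult_le_one)
  have "cube_integral ?f = \<beta> * 6 ^ n / (2 ^ n) ^ 3"
    by (simp add: cube_integral_grid_function sum_no_mono_digit flip: sum_distrib_left)
  also have "\<dots> = \<beta> * (3/4) ^ n"
  proof -
    have ratio: "(6::real) ^ n / (2 ^ n) ^ 3 = (6 / 2 ^ 3) ^ n"
      unfolding power_divide by (simp only: mult.commute flip: power_mult)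
    show ?thesis
      by (simp only: times_divide_eq_right[symmetric] ratio) simp
  qed
  finally have density: "cube_integral ?f = \<beta> * (3/4) ^ n" .
  have "T ?f = (\<Sum>k<2 ^ n. \<Sum>j<2 ^ n. \<Sum>i<2 ^ n. \<beta> ^ 3 * ((\<Sum>k'<2 ^ n. no_mono_digit n i j k') *
      (\<Sum>j'<2 ^ n. no_mono_digit n i j' k) * (\<Sum>i'<2 ^ n. no_mono_digit n i' j k))) / (2 ^ n) ^ 6"
    by (simp add: T_grid_function power3_eq_cube mult_ac flip: sum_distrib_left)
  also have "\<dots> = \<beta> ^ 3 * 26 ^ n / (2 ^ n) ^ 6"
    by (simp only: sum_no_mono_digit_lines flip: sum_distrib_left)
  also have "\<dots> = \<beta> ^ 3 * (13/32) ^ n"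
  proof -
    have ratio: "(26::real) ^ n / (2 ^ n) ^ 6 = (26 / 2 ^ 6) ^ n"
      unfolding power_divide by (simp only: mult.commute flip: power_mult)
    show ?thesis
      by (simp only: times_divide_eq_right[symmetric] ratio) simp
  qed
  finally have "T ?f = \<beta> ^ 3 * (13/32) ^ n" .
  with m_le_T[OF pc density] show ?thesis by simp
qed

lemma between_consecutive_powers:
  fixes q \<alpha> :: real
  assumes "0 < q" "q < 1" "0 < \<alpha>" "\<alpha> \<le> 1"
  obtains n where "q ^ Suc n \<le> \<alpha>" "\<alpha> \<le> q ^ n"
proof -
  have ex: "\<exists>k. q ^ Suc k \<le> \<alpha>"
  proof -
    obtain k where "q ^ k < \<alpha>"
      using real_arch_pow_inv[of \<alpha> q] assms by blast
    moreover have "q ^ Suc k \<le> q ^ k"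
      using assms by (simp add: mult_left_le_one_le)
    ultimately show ?thesis
      by (intro exI[of _ k]) linarith
  qed
  define n where "n = (LEAST k. q ^ Suc k \<le> \<alpha>)"
  have "q ^ Suc n \<le> \<alpha>"
    unfolding n_def by (rule LeastI_ex[OF ex])
  moreover have "\<alpha> \<le> q ^ n"
  proof (cases n)
    case 0
    then show ?thesis using assms by simp
  next
    case (Suc l)
    then have "\<not> q ^ Suc l \<le> \<alpha>"
      using not_less_Least[of l "\<lambda>k. q ^ Suc k \<le> \<alpha>"] by (simp add: n_def)
    then show ?thesis using Suc by simp
  qed
  ultimately show thesis by (rule that)
qed

theorem theorem6:
  fixes c \<alpha> :: real
  assumes "c = ln (26/27) / ln (3/4)"
    and "\<alpha> \<in> {0..1}"
  shows "m \<alpha> \<le> 27/26 * \<alpha> powr (3 + c)"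
proof (cases "\<alpha> = 0")
  case True
  then show ?thesis
    using m_scaled_power_le[of 0 0] by simp
next
  case False
  then have "\<alpha> > 0" using assms by simp
  obtain n where n: "(3/4) ^ Suc n \<le> \<alpha>" "\<alpha> \<le> (3/4) ^ n"
    using between_consecutive_powers[of "3/4" \<alpha>] \<open>\<alpha> > 0\<close> assms(2) by auto
  define \<beta> where "\<beta> = \<alpha> / (3/4) ^ n"
  have \<alpha>: "\<alpha> = \<beta> * (3/4) ^ n"
    by (simp add: \<beta>_def)
  have \<beta>: "3/4 \<le> \<beta>" "\<beta> \<le> 1"
    using n by (simp_all add: \<beta>_def field_simps)
  have "c \<ge> 0"
    unfolding assms(1) by (intro divide_nonpos_nonpos) auto
  have c: "(3/4) powr c = 26/27"
    by (simp add: powr_def assms(1))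
  have "(26/27::real) \<le> \<beta> powr c"
    using powr_mono2[of c "3/4" \<beta>] \<open>c \<ge> 0\<close> \<beta> c by simp
  \<comment> \<open>The exponent is chosen so that the building block attains the bound with constant 1.\<close>
  have base: "(3/4) powr (3 + c) = 13/32"
    using c by (simp add: powr_add power3_eq_cube)
  have powers: "((3/4) ^ n) powr (3 + c) = (13/32) ^ n"
    by (induction n) (simp_all only: power_Suc powr_mult base power_0 powr_one_eq_one)
  have "m \<alpha> \<le> \<beta> ^ 3 * (13/32) ^ n"
    unfolding \<alpha> using \<beta> by (intro m_scaled_power_le) auto
  also have "\<dots> \<le> (27/26 * \<beta> powr c) * (\<beta> ^ 3 * (13/32) ^ n)"
    using mult_right_mono[of 1 "27/26 * \<beta> powr c" "\<beta> ^ 3 * (13/32) ^ n"]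
      \<open>26/27 \<le> \<beta> powr c\<close> \<beta> by simp
  also have "\<dots> = 27/26 * (\<beta> powr (3 + c) * ((3/4) ^ n) powr (3 + c))"
    using \<beta> unfolding powers by (simp add: powr_add)
  also have "\<dots> = 27/26 * \<alpha> powr (3 + c)"
    using \<beta> unfolding \<alpha> by (simp add: powr_mult)
  finally show ?thesis .
qed

end
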